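(* Let $\boldsymbol\theta=(\theta_1,\dots,\theta_m)\in\mathbb{R}^m$ be fixed, and let $z_1,\dots,z_m$ be independent real random variables, $z_i$ having distribution function $F_{i,\theta_i}$ and density $f_{i,\theta_i}$, where for each $i$ the family $\{F_{i,\theta}\}_{\theta\in\mathbb{R}}$ satisfies: (1) (symmetry of the null) $F_{i,0}$ is known, and $F_{i,0}(-z)=1-F_{i,0}(z)$ and $f_{i,0}(-z)=f_{i,0}(z)$ for all $z\in\mathbb{R}$; (2) (monotone likelihood ratio) for all $\theta<\theta^*$ and $z<z^*$, $\frac{f_{i,\theta^*}(z)}{f_{i,\theta}(z)}\le\frac{f_{i,\theta^*}(z^* )}{f_{i,\theta}(z^* )}$. Let $q\in(0,1)$. Then the ZDIRECT procedure described in the context, run at level $q$, controls the directional false discovery rate at level $q$. Specifically, if the procedure terminates at step $\hat t=\min\{t:\widehat{\mathrm{FDR}}_{\mathrm{dir}}(t)\le q\}$, then $$\mathbb{E}_{\boldsymbol\theta}\left[\frac{|\{i:\mathrm{sgn}(\theta_i)\ne\mathrm{sgn}(z_i)\text{ and }i\in\mathcal{R}_{\hat t}\}|}{1\vee|\mathcal{R}_{\hat t}|}\right]\le q .$$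
   Context: For each $i\in[m]=\{1,\dots,m\}$ and $\theta\in\mathbb{R}$, $F_{i,\theta}$ is a smooth, strictly increasing distribution function on $\mathbb{R}$ with density $f_{i,\theta}=F_{i,\theta}'>0$ with respect to Lebesgue measure. $\mathbb{E}_{\boldsymbol\theta}$ denotes (frequentist) expectation for the fixed parameter values $\theta_1,\dots,\theta_m$. $\mathrm{sgn}(x)=\mathbf 1(x>0)-\mathbf 1(x<0)$, $a\vee b=\max(a,b)$, $a\wedge b=\min(a,b)$. The directional false discovery rate of a procedure that declares the signs $\mathrm{sgn}(z_i)$ for the indices $i$ in a data-dependent set $\mathcal{R}\subseteq[m]$ is the expectation of the number of $i\in\mathcal{R}$ with $\mathrm{sgn}(\theta_i)\ne\mathrm{sgn}(z_i)$ divided by $1\vee|\mathcal{R}|$. Transformed data. For each $i$: $u_i=F_{i,0}(z_i)\in(0,1)$; its reflection is $\check u_i=0.5-u_i$ if $u_i\le 0.5$ and $\check u_i=1.5-u_i$ if $u_i>0.5$; and the masked value is $u_i'=u_i\wedge\check u_i$ if $u_i,\check u_i\in[0,0.5]$ and $u_i'=u_i\vee\check u_i$ if $u_i,\check u_i\in(0.5,1)$. ZDIRECT procedure at level $q$. Start with $\mathcal{M}_0=[m]$. At step $t=0,1,2,\dots$, form $$\mathcal{A}_t=\{i\in\mathcal{M}_t:u_i\in(0.25,0.75)\},\qquad \mathcal{R}_t=\{i\in\mathcal{M}_t:u_i\in(0,0.25]\cup[0.75,1)\},$$ $$\widehat{\mathrm{FDR}}_{\mathrm{dir}}(t)=\frac{1+|\mathcal{A}_t|}{|\mathcal{R}_t|\vee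 1}.$$ If $\widehat{\mathrm{FDR}}_{\mathrm{dir}}(t)\le q$, set $\hat t=t$, stop, and output the sign declarations $\mathrm{sgn}(z_i)$ for $i\in\mathcal{R}_{\hat t}$. If $\widehat{\mathrm{FDR}}_{\mathrm{dir}}(t)>q$, construct $\mathcal{M}_{t+1}$, by any rule respecting the following two conditions, and go on to step $t+1$: (C1) $\mathcal{M}_{t+1}$ must be constructed based only on the partially masked data $\{\tilde u_{i,t}\}_{i\in[m]}$ available at step $t$, where $\tilde u_{i,t}=u_i$ if $i\notin\mathcal{M}_t$ and $\tilde u_{i,t}=u_i'$ if $i\in\mathcal{M}_t$; (C2) $\mathcal{M}_{t+1}$ must be a strict subset of $\mathcal{M}_t$ (to ensure that the procedure terminates). *)

theory Defs
  imports "HOL-Probability.Probability"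
begin

definition smooth :: "(real \<Rightarrow> real) \<Rightarrow> bool" where
  "smooth g \<longleftrightarrow> (\<forall>n x. (deriv ^^ n) g differentiable (at x))"

definition regular_family :: "(real \<Rightarrow> real \<Rightarrow> real) \<Rightarrow> (real \<Rightarrow> real \<Rightarrow> real) \<Rightarrow> bool" where
  "regular_family F f \<longleftrightarrow>
     (\<forall>\<theta>. real_distribution (density lborel (\<lambda>x. ennreal (f \<theta> x))) \<and>
          F \<theta> = cdf (density lborel (\<lambda>x. ennreal (f \<theta> x))) \<and>
          smooth (F \<theta>) \<and> strict_mono (F \<theta>) \<and>
          (\<forall>x. (F \<theta> has_real_derivative f \<theta> x) (at x)) \<and>
          (\<forall>x. f \<theta> x > 0))"

definition symmetric_null :: "(real \<Rightarrow> real \<Rightarrow> real) \<Rightarrow> (real \<Rightarrow> real \<Rightarrow> real) \<Rightarrow> bool" where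
  "symmetric_null F f \<longleftrightarrow> (\<forall>x. F 0 (- x) = 1 - F 0 x \<and> f 0 (- x) = f 0 x)"

definition monotone_likelihood_ratio :: "(real \<Rightarrow> real \<Rightarrow> real) \<Rightarrow> bool" where
  "monotone_likelihood_ratio f \<longleftrightarrow>
     (\<forall>\<theta> \<theta>' x x'. \<theta> < \<theta>' \<longrightarrow> x < x' \<longrightarrow> f \<theta>' x / f \<theta> x \<le> f \<theta>' x' / f \<theta> x')"

definition reflection :: "real \<Rightarrow> real" where
  "reflection u = (if u \<le> 1/2 then 1/2 - u else 3/2 - u)"

text \<open>For \<open>u\<close> in \<open>(0,1)\<close>, the second branch is the case where both \<open>u\<close> and its reflection
  lie in \<open>(1/2,1)\<close>.\<close>

definition masked_value :: "real \<Rightarrow> real" where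
  "masked_value u =
     (if u \<in> {0..1/2} \<and> reflection u \<in> {0..1/2} then min u (reflection u)
      else max u (reflection u))"

definition partially_masked :: "nat \<Rightarrow> nat set \<Rightarrow> (nat \<Rightarrow> real) \<Rightarrow> nat \<Rightarrow> real" where
  "partially_masked m M u = (\<lambda>i\<in>{1..m}. if i \<in> M then masked_value (u i) else u i)"

text \<open>An update rule \<open>upd\<close> produces the next masked set from the step number and the partially
  masked data alone. The current masked set is not a separate argument: the partially masked
  data determine all the fully masked values, so the earlier masked sets, and hence the current
  one, can be recomputed from them.

  The empty set has no strict subset, so a run that reaches it cannot be continued. It is kept
  empty from then on. The estimate below is then \<open>1\<close>, so at a level less than \<open>1\<close> such a run
  never meets the stopping criterion.\<close>

primrec masked_set :: "nat \<Rightarrow> (nat \<Rightarrow> (nat \<Rightarrow> real) \<Rightarrow> nat set) \<Rightarrow> (nat \<Rightarrow> real) \<Rightarrow> nat \<Rightarrow> nat set" where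
  "masked_set m upd u 0 = {1..m}"
| "masked_set m upd u (Suc t) =
     (if masked_set m upd u t = {} then {}
      else upd t (partially_masked m (masked_set m upd u t) u))"

definition acceptance_set :: "nat \<Rightarrow> (nat \<Rightarrow> (nat \<Rightarrow> real) \<Rightarrow> nat set) \<Rightarrow> (nat \<Rightarrow> real) \<Rightarrow> nat \<Rightarrow> nat set" where
  "acceptance_set m upd u t = {i \<in> masked_set m upd u t. u i \<in> {1/4<..<3/4}}"

definition rejection_set :: "nat \<Rightarrow> (nat \<Rightarrow> (nat \<Rightarrow> real) \<Rightarrow> nat set) \<Rightarrow> (nat \<Rightarrow> real) \<Rightarrow> nat \<Rightarrow> nat set" where
  "rejection_set m upd u t = {i \<in> masked_set m upd u t. u i \<in> {0<..1/4} \<union> {3/4..<1}}"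

definition fdr_dir_hat :: "nat \<Rightarrow> (nat \<Rightarrow> (nat \<Rightarrow> real) \<Rightarrow> nat set) \<Rightarrow> (nat \<Rightarrow> real) \<Rightarrow> nat \<Rightarrow> real" where
  "fdr_dir_hat m upd u t =
     (1 + real (card (acceptance_set m upd u t))) / real (max (card (rejection_set m upd u t)) 1)"

text \<open>The strict-subset condition is imposed only at steps the procedure actually performs.
  Measurability of the rule is what makes the expectation of the resulting false discovery
  proportion meaningful.\<close>

definition admissible_update :: "nat \<Rightarrow> real \<Rightarrow> (nat \<Rightarrow> (nat \<Rightarrow> real) \<Rightarrow> nat set) \<Rightarrow> bool" where
  "admissible_update m q upd \<longleftrightarrow>
     (\<forall>t. upd t \<in> measurable (PiM {1..m} (\<lambda>_. borel)) (count_space (Pow {1..m}))) \<and>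
     (\<forall>u t. (\<forall>i\<in>{1..m}. u i \<in> {0<..<1}) \<longrightarrow>
            (\<forall>s\<le>t. fdr_dir_hat m upd u s > q) \<longrightarrow>
            masked_set m upd u t \<noteq> {} \<longrightarrow>
            masked_set m upd u (Suc t) \<subset> masked_set m upd u t)"

text \<open>The set of indices whose signs are declared. A run that exhausts the masked set without
  meeting the stopping criterion declares nothing.\<close>

definition zdirect :: "nat \<Rightarrow> real \<Rightarrow> (nat \<Rightarrow> (nat \<Rightarrow> real) \<Rightarrow> nat set) \<Rightarrow> (nat \<Rightarrow> real) \<Rightarrow> nat set" where
  "zdirect m q upd u =
     (if \<exists>t. fdr_dir_hat m upd u t \<le> q
      then rejection_set m upd u (LEAST t. fdr_dir_hat m upd u t \<le> q)
      else {})"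

definition directional_fdr ::
  "'a measure \<Rightarrow> (nat \<Rightarrow> real) \<Rightarrow> (nat \<Rightarrow> 'a \<Rightarrow> real) \<Rightarrow> ('a \<Rightarrow> nat set) \<Rightarrow> real" where
  "directional_fdr P \<theta> z R =
     prob_space.expectation P
       (\<lambda>\<omega>. real (card {i \<in> R \<omega>. sgn (\<theta> i) \<noteq> sgn (z i \<omega>)}) / real (max 1 (card (R \<omega>))))"

end

theory Submission
  imports Defs
begin

text \<open>Write \<open>G i u\<close> for the reciprocal of one plus the number of accepted indices with a wrong sign at
  the stopping time, if \<open>i\<close> is then a rejection with a wrong sign, and \<open>0\<close> otherwise. The stopping
  criterion bounds the false discovery proportion by \<open>q\<close> times the sum of the \<open>G i u\<close>. Where the
  sign is wrong, the monotone likelihood ratio makes the density of \<open>u i\<close> larger at the reflection of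
  a rejected value than at the value itself, so reflecting the coordinate \<open>i\<close> can only increase the
  expectation of \<open>G i\<close>. After the reflections the sum is at most \<open>1\<close> pointwise: all indices that
  contribute belong to one common set of accepted indices with a wrong sign, and each contributes the
  reciprocal of the size of this set.\<close>

subsection \<open>The masked sets under reflection of one coordinate\<close>

text \<open>If no step meets the criterion, \<open>LEAST\<close> is an arbitrary number;
  \<open>false_rejection\<close> therefore asks separately that such a step exists.\<close>

definition stop_step :: "nat \<Rightarrow> real \<Rightarrow> (nat \<Rightarrow> (nat \<Rightarrow> real) \<Rightarrow> nat set) \<Rightarrow> (nat \<Rightarrow> real) \<Rightarrow> nat" where
  "stop_step m q upd u = (LEAST t. fdr_dir_hat m upd u t \<le> q)"

definition final_set :: "nat \<Rightarrow> real \<Rightarrow> (nat \<Rightarrow> (nat \<Rightarrow> real) \<Rightarrow> nat set) \<Rightarrow> (nat \<Rightarrow> real) \<Rightarrow> nat set" where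
  "final_set m q upd u = masked_set m upd u (stop_step m q upd u)"

text \<open>The sign of \<open>u j - 1/2\<close> stands in for that of the observation, since a
  symmetric null takes the value 1/2 at 0. The set \<open>M\<close> is a parameter so that one
  masked set can be combined with a vector and with its reflections.\<close>

definition false_acceptances :: "(nat \<Rightarrow> real) \<Rightarrow> nat set \<Rightarrow> (nat \<Rightarrow> real) \<Rightarrow> nat set" where
  "false_acceptances \<theta> M u = {j \<in> M. u j \<in> {1/4<..<3/4} \<and> sgn (\<theta> j) \<noteq> sgn (u j - 1/2)}"

text \<open>The three excluded values have probability zero. Away from them, reflection is an involution
  of the unit interval that preserves the declared sign and swaps rejection and acceptance.\<close>

definition generic :: "nat \<Rightarrow> (nat \<Rightarrow> real) \<Rightarrow> bool" where
  "generic m u \<longleftrightarrow> (\<forall>j\<in>{1..m}. u j \<in> {0<..<1} - {1/4, 1/2, 3/4})"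

text \<open>The thresholds 1/4 and 3/4 are fixed by reflection and would not turn into acceptances,
  hence the open intervals.\<close>

definition false_rejection ::
  "nat \<Rightarrow> real \<Rightarrow> (nat \<Rightarrow> (nat \<Rightarrow> real) \<Rightarrow> nat set) \<Rightarrow> (nat \<Rightarrow> real) \<Rightarrow> nat \<Rightarrow> (nat \<Rightarrow> real) \<Rightarrow> bool" where
  "false_rejection m q upd \<theta> i u \<longleftrightarrow>
     generic m u \<and> (\<exists>t. fdr_dir_hat m upd u t \<le> q) \<and> i \<in> final_set m q upd u \<and>
     u i \<in> {0<..<1/4} \<union> {3/4<..<1} \<and> sgn (\<theta> i) \<noteq> sgn (u i - 1/2)"

text \<open>The 1 in the denominator counts \<open>i\<close> itself, which becomes an acceptance
  with the same wrong sign once its coordinate is reflected.\<close>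

definition false_rejection_weight ::
  "nat \<Rightarrow> real \<Rightarrow> (nat \<Rightarrow> (nat \<Rightarrow> real) \<Rightarrow> nat set) \<Rightarrow> (nat \<Rightarrow> real) \<Rightarrow> nat \<Rightarrow> (nat \<Rightarrow> real) \<Rightarrow> real" where
  "false_rejection_weight m q upd \<theta> i u =
     (if false_rejection m q upd \<theta> i u
      then 1 / (1 + real (card (false_acceptances \<theta> (final_set m q upd u) u))) else 0)"

lemma masked_set_subset:
  assumes "admissible_update m q upd"
  shows "masked_set m upd u t \<subseteq> {1..m}"
proof (cases t)
  case (Suc s)
  have "upd s \<in> measurable (PiM {1..m} (\<lambda>_. borel)) (count_space (Pow {1..m}))"
    using assms by (simp add: admissible_update_def)
  \<comment> \<open>A partially masked vector is undefined outside \<open>{1..m}\<close>, hence a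
    point of the product space on which \<open>upd s\<close> is measurable.\<close>
  then have "upd s (partially_masked m M u) \<in> Pow {1..m}" for M
    using measurable_space[of "upd s" "PiM {1..m} (\<lambda>_. borel)" "count_space (Pow {1..m})" "partially_masked m M u"]
    by (simp add: space_PiM partially_masked_def)
  then show ?thesis
    using Suc by auto
qed simp

text \<open>Admissibility demands shrinking only at steps that are performed, hence the condition on
  the estimates before \<open>t\<close>. An empty masked set stays empty by definition.\<close>

lemma masked_set_antimono:
  assumes adm: "admissible_update m q upd" and u: "\<forall>i\<in>{1..m}. u i \<in> {0<..<1}"
    and "s \<le> t" and "\<And>r. r < t \<Longrightarrow> fdr_dir_hat m upd u r > q"
  shows "masked_set m upd u t \<subseteq> masked_set m upd u s"
  using assms(3,4)
proof (induction t rule: dec_induct)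
  case (step n)
  have "masked_set m upd u (Suc n) \<subseteq> masked_set m upd u n"
  proof (cases "masked_set m upd u n = {}")
    case False
    have "\<forall>r\<le>n. fdr_dir_hat m upd u r > q"
      using step.prems by simp
    then show ?thesis
      using adm u False unfolding admissible_update_def by blast
  qed simp
  moreover have "masked_set m upd u n \<subseteq> masked_set m upd u s"
    using step.prems by (intro step.IH) simp
  ultimately show ?case by blast
qed simp

text \<open>While coordinate \<open>i\<close> is masked, the rule sees it only through its masked
  value, so both vectors feed it the same data.\<close>

lemma masked_set_fun_upd:
  assumes "\<And>r. r < t \<Longrightarrow> i \<in> masked_set m upd u r" and "masked_value y = masked_value (u i)"
  shows "masked_set m upd (u(i := y)) t = masked_set m upd u t"
  using assms(1)
proof (induction t)
  case (Suc t)
  have "masked_set m upd (u(i := y)) t = masked_set m upd u t"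
    using Suc.prems by (intro Suc.IH) simp
  moreover have "partially_masked m M (u(i := y)) = partially_masked m M u" if "i \<in> M" for M
    using that assms(2) by (auto simp: partially_masked_def restrict_def)
  ultimately show ?case
    using Suc.prems[OF lessI] by (simp only: masked_set.simps)
qed simp

text \<open>In the application it is the run on the altered vector whose masked sets are known to
  contain \<open>i\<close>; the two vectors exchange roles.\<close>

lemma masked_set_fun_upd':
  assumes "\<And>r. r < t \<Longrightarrow> i \<in> masked_set m upd (u(i := y)) r" and "masked_value y = masked_value (u i)"
  shows "masked_set m upd (u(i := y)) t = masked_set m upd u t"
  using masked_set_fun_upd[of t i m upd "u(i := y)" "u i"] assms by simp

text \<open>All reflections contributing to the sum stop at the same step with the same masked set:
  reflecting a masked coordinate is invisible to the update rule, and turning one acceptance into a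
  rejection changes the counts in the same way whichever coordinate is reflected.\<close>

lemma sum_false_rejection_weight_reflection_le_1:
  assumes adm: "admissible_update m q upd" and u: "\<forall>i\<in>{1..m}. u i \<in> {0<..<1}"
  shows "(\<Sum>i\<in>{1..m}. false_rejection_weight m q upd \<theta> i (u(i := reflection (u i)))) \<le> 1"
proof -
  define v where "v i = u(i := reflection (u i))" for i
  define I where "I = {i \<in> {1..m}. false_rejection m q upd \<theta> i (v i)}"
  define \<tau> where "\<tau> i = stop_step m q upd (v i)" for i
  have sum_eq: "(\<Sum>i\<in>{1..m}. false_rejection_weight m q upd \<theta> i (v i)) =
      (\<Sum>i\<in>I. false_rejection_weight m q upd \<theta> i (v i))"
    by (intro sum.mono_neutral_right) (auto simp: I_def false_rejection_weight_def)
  have [simp]: "finite I"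
    by (simp add: I_def)
  \<comment> \<open>The reflected value lies in an open rejection interval, which places
    \<open>u i\<close> in the acceptance interval; the value 1/2 is ruled out because its reflection
    is 0.\<close>
  have ui: "u i \<in> {1/4<..<1/2} \<union> {1/2<..<3/4} \<and> sgn (reflection (u i) - 1/2) = sgn (u i - 1/2)
      \<and> reflection (u i) \<in> {0<..<1/4} \<union> {3/4<..<1}
      \<and> masked_value (reflection (u i)) = masked_value (u i)"
    if "i \<in> I" for i
  proof -
    have "reflection (u i) \<in> {0<..<1/4} \<union> {3/4<..<1}" "u i \<in> {0<..<1}"
      using that u by (auto simp: I_def false_rejection_def v_def)
    then show ?thesis
      by (auto simp: reflection_def masked_value_def sgn_if split: if_splits)
  qed
  have wrong: "sgn (\<theta> i) \<noteq> sgn (u i - 1/2)" if "i \<in> I" for i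
    using ui[OF that] that by (auto simp: I_def false_rejection_def v_def)
  have v01: "\<forall>j\<in>{1..m}. v i j \<in> {0<..<1}" if "i \<in> I" for i
    using that by (auto simp: I_def false_rejection_def generic_def)
  have stop: "fdr_dir_hat m upd (v i) (\<tau> i) \<le> q" if i: "i \<in> I" for i
  proof -
    obtain t where "fdr_dir_hat m upd (v i) t \<le> q"
      using i unfolding I_def false_rejection_def by blast
    then show ?thesis
      unfolding \<tau>_def stop_step_def by (rule LeastI)
  qed
  have masked_anti: "masked_set m upd (v i) (\<tau> i) \<subseteq> masked_set m upd (v i) s"
    if "i \<in> I" "s \<le> \<tau> i" for i s
    using adm v01[OF that(1)] that(2)
  proof (rule masked_set_antimono)
    fix r assume "r < \<tau> i"
    then show "q < fdr_dir_hat m upd (v i) r"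
      unfolding \<tau>_def stop_step_def using not_less_Least by fastforce
  qed
  have i_masked: "i \<in> masked_set m upd (v i) s" if "i \<in> I" "s \<le> \<tau> i" for i s
    using masked_anti[OF that] that(1) by (auto simp: I_def false_rejection_def final_set_def \<tau>_def)
  \<comment> \<open>The masked sets decrease and \<open>i\<close> belongs to the one at
    \<open>\<tau> i\<close>, so coordinate \<open>i\<close> stays masked until then and the runs on
    \<open>v i\<close> and \<open>u\<close> agree.\<close>
  have masked_eq: "masked_set m upd (v i) s = masked_set m upd u s" if "i \<in> I" "s \<le> \<tau> i" for i s
    unfolding v_def
  proof (rule masked_set_fun_upd')
    show "i \<in> masked_set m upd (u(i := reflection (u i))) r" if "r < s" for r
      using i_masked[OF \<open>i \<in> I\<close>, of r] \<open>s \<le> \<tau> i\<close> \<open>r < s\<close> by (simp add: v_def)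
  qed (use ui[OF that(1)] in simp)
  show ?thesis
  proof (cases "I = {}")
    case True
    then show ?thesis
      using sum_eq by (simp add: v_def)
  next
    case False
    \<comment> \<open>Choose the run that stops first. No contributing run stops before
      \<open>\<tau> k\<close>, so at that step all of them share the masked set
      \<open>M\<close>.\<close>
    then obtain k where k: "k \<in> I" "\<And>j. j \<in> I \<Longrightarrow> \<tau> k \<le> \<tau> j"
      using ex_has_least_nat[of "\<lambda>j. j \<in> I" _ \<tau>] by blast
    define M where "M = masked_set m upd u (\<tau> k)"
    have finM [simp]: "finite M"
      using masked_set_subset[OF adm] finite_subset unfolding M_def by blast
    have Mj: "masked_set m upd (v j) (\<tau> k) = M" "j \<in> M" if "j \<in> I" for j
      using masked_eq[OF that k(2)[OF that]] i_masked[OF that k(2)[OF that]] by (auto simp: M_def)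
    define A where "A = {i \<in> M. u i \<in> {1/4<..<3/4}}"
    define R where "R = {i \<in> M. u i \<in> {0<..1/4} \<union> {3/4..<1}}"
    \<comment> \<open>Reflecting \<open>j\<close> moves it from \<open>A\<close> to
      \<open>R\<close>; the 1 in the numerator restores the lost acceptance, and the result does not
      depend on \<open>j\<close>. Hence every run meets the criterion when the first one
      does.\<close>
    have hat: "fdr_dir_hat m upd (v j) (\<tau> k) = real (card A) / real (max (Suc (card R)) 1)"
      if "j \<in> I" for j
    proof -
      have "acceptance_set m upd (v j) (\<tau> k) = A - {j}"
        unfolding acceptance_set_def Mj(1)[OF that]
        using ui[OF that] by (auto simp: A_def v_def)
      moreover have "j \<in> A" "finite A"
        using ui[OF that] Mj(2)[OF that] by (auto simp: A_def)
      ultimately have 1: "1 + card (acceptance_set m upd (v j) (\<tau> k)) = card A"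
        using card_Suc_Diff1[of A j] by simp
      have "rejection_set m upd (v j) (\<tau> k) = insert j R"
        unfolding rejection_set_def Mj(1)[OF that]
        using ui[OF that] Mj(2)[OF that] by (auto simp: R_def v_def)
      moreover have "j \<notin> R" "finite R"
        using ui[OF that] by (auto simp: R_def)
      ultimately have "card (rejection_set m upd (v j) (\<tau> k)) = Suc (card R)"
        by simp
      with 1 show ?thesis
        by (simp add: fdr_dir_hat_def flip: of_nat_Suc)
    qed
    have \<tau>_eq: "\<tau> j = \<tau> k" if "j \<in> I" for j
    proof (rule antisym)
      have "fdr_dir_hat m upd (v j) (\<tau> k) \<le> q"
        using hat[OF that] hat[OF k(1)] stop[OF k(1)] by simp
      then show "\<tau> j \<le> \<tau> k"
        unfolding \<tau>_def[of j] stop_step_def by (rule Least_le)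
    qed (rule k(2)[OF that])
    \<comment> \<open>Passing to \<open>v j\<close> removes exactly \<open>j\<close> from
      \<open>W\<close>, and the 1 in the weight restores it. Thus the sum is
      \<open>card I / card W\<close>, with \<open>I\<close> inside \<open>W\<close>.\<close>
    define W where "W = false_acceptances \<theta> M u"
    have finW: "finite W"
      by (simp add: W_def false_acceptances_def)
    have IW: "I \<subseteq> W"
      using ui wrong Mj(2) by (fastforce simp: W_def false_acceptances_def)
    have "false_rejection_weight m q upd \<theta> j (v j) = 1 / real (card W)" if "j \<in> I" for j
    proof -
      have "final_set m q upd (v j) = M"
        using Mj(1)[OF that] \<tau>_eq[OF that] by (simp add: final_set_def \<tau>_def)
      moreover have "false_acceptances \<theta> M (v j) = W - {j}"
        using ui[OF that] by (auto simp: false_acceptances_def W_def v_def)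
      moreover have "Suc (card (W - {j})) = card W"
        using card_Suc_Diff1[OF finW] IW that by auto
      ultimately show ?thesis
        using that by (simp add: false_rejection_weight_def I_def flip: of_nat_Suc)
    qed
    then have "(\<Sum>i\<in>I. false_rejection_weight m q upd \<theta> i (v i)) = real (card I) / real (card W)"
      by simp
    also have "\<dots> \<le> 1"
      using card_mono[OF finW IW] by (simp add: divide_le_eq)
    finally show ?thesis
      using sum_eq by (simp add: v_def)
  qed
qed

text \<open>At the stopping step \<open>1 + card A\<close> is at most
  \<open>q * max 1 (card R)\<close>, and the wrong acceptances \<open>W\<close> are among
  \<open>A\<close>, so each false rejection costs at most \<open>q / (1 + card W)\<close>. Without a
  stop nothing is declared.\<close>

lemma fdp_le_sum_false_rejection_weight:
  assumes adm: "admissible_update m q upd" and u: "generic m u" and q: "q > 0"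
  shows "real (card {i \<in> zdirect m q upd u. sgn (\<theta> i) \<noteq> sgn (u i - 1/2)})
           / real (max 1 (card (zdirect m q upd u)))
         \<le> q * (\<Sum>i\<in>{1..m}. false_rejection_weight m q upd \<theta> i u)"
proof (cases "\<exists>t. fdr_dir_hat m upd u t \<le> q")
  case False
  then show ?thesis
    using q by (auto simp: zdirect_def false_rejection_weight_def intro!: mult_nonneg_nonneg sum_nonneg)
next
  case True
  define \<tau> where "\<tau> = stop_step m q upd u"
  define M where "M = masked_set m upd u \<tau>"
  define R where "R = rejection_set m upd u \<tau>"
  define A where "A = acceptance_set m upd u \<tau>"
  define W where "W = false_acceptances \<theta> M u"
  define V where "V = {i \<in> R. sgn (\<theta> i) \<noteq> sgn (u i - 1/2)}"
  have M: "M \<subseteq> {1..m}" "finite M"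
    using masked_set_subset[OF adm] finite_subset[of M "{1..m}"] by (auto simp: M_def)
  have Z: "zdirect m q upd u = R"
    using True by (simp add: zdirect_def R_def \<tau>_def stop_step_def)
  have "fdr_dir_hat m upd u \<tau> \<le> q"
    using True unfolding \<tau>_def stop_step_def by (rule LeastI_ex)
  then have hat: "1 + real (card A) \<le> q * real (max 1 (card R))"
    by (simp add: fdr_dir_hat_def A_def R_def divide_le_eq max.commute)
  have "card W \<le> card A"
    using M by (intro card_mono) (auto simp: W_def A_def M_def false_acceptances_def acceptance_set_def)
  with hat have "1 + real (card W) \<le> q * real (max 1 (card R))"
    by linarith
  then have le: "1 / real (max 1 (card R)) \<le> q / (1 + real (card W))"
    by (simp add: field_simps)
  have VM: "V \<subseteq> {1..m}"
    using M by (auto simp: V_def R_def rejection_set_def M_def)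
  have weight: "false_rejection_weight m q upd \<theta> i u = (if i \<in> V then 1 / (1 + real (card W)) else 0)"
    if "i \<in> {1..m}" for i
  proof -
    have "u i \<in> {0<..<1} - {1/4, 1/2, 3/4}"
      using u that by (simp add: generic_def)
    then have "false_rejection m q upd \<theta> i u \<longleftrightarrow> i \<in> V"
      using u True
      by (auto simp: false_rejection_def V_def R_def rejection_set_def final_set_def \<tau>_def)
    then show ?thesis
      by (simp add: false_rejection_weight_def W_def M_def \<tau>_def final_set_def)
  qed
  have "(\<Sum>i\<in>{1..m}. false_rejection_weight m q upd \<theta> i u) =
      (\<Sum>i\<in>{1..m}. if i \<in> V then 1 / (1 + real (card W)) else 0)"
    by (intro sum.cong refl weight)
  also have "\<dots> = real (card V) / (1 + real (card W))"
    using VM by (simp add: sum.If_cases Int_absorb1)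
  finally have "q * (\<Sum>i\<in>{1..m}. false_rejection_weight m q upd \<theta> i u) =
      real (card V) * (q / (1 + real (card W)))"
    by simp
  moreover have "real (card V) * (1 / real (max 1 (card R))) \<le> real (card V) * (q / (1 + real (card W)))"
    by (intro mult_left_mono le) simp
  ultimately show ?thesis
    by (simp add: Z V_def)
qed

subsection \<open>Reflection and the likelihood ratio\<close>

lemma borel_measurable_reflection [measurable]: "reflection \<in> borel_measurable borel"
  unfolding reflection_def by measurable

text \<open>Each half of the unit interval is reversed in place, which preserves Lebesgue measure;
  the common endpoint 1/2 is a null set.\<close>

lemma nn_integral_reflection:
  assumes [measurable]: "k \<in> borel_measurable borel"
  shows "(\<integral>\<^sup>+u. k (reflection u) * indicator {0<..<1} u \<partial>lborel) =
         (\<integral>\<^sup>+u. k u * indicator {0<..<1} u \<partial>lborel)"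
proof -
  have split: "(\<integral>\<^sup>+u. h u * indicator {0<..<1} u \<partial>lborel) =
      (\<integral>\<^sup>+u. h u * indicator {0<..<1/2} u \<partial>lborel) + (\<integral>\<^sup>+u. h u * indicator {1/2<..<1} u \<partial>lborel)"
    if [measurable]: "h \<in> borel_measurable borel" for h :: "real \<Rightarrow> ennreal"
  proof -
    have "(\<integral>\<^sup>+u. h u * indicator {0<..<1} u \<partial>lborel) =
        (\<integral>\<^sup>+u. h u * indicator {0<..<1/2} u + h u * indicator {1/2<..<1} u \<partial>lborel)"
      using AE_lborel_singleton[of "1/2::real"]
      by (intro nn_integral_cong_AE) (auto elim!: eventually_mono split: split_indicator)
    then show ?thesis
      by (simp add: nn_integral_add)
  qed
  have half: "(\<integral>\<^sup>+u. k (c - u) * indicator {a<..<b} u \<partial>lborel) = (\<integral>\<^sup>+u. k u * indicator {a<..<b} u \<partial>lborel)"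
    if "c = a + b" for a b c :: real
    using nn_integral_real_affine[of "\<lambda>u. k u * indicator {a<..<b} u" "-1" c] that
    by (auto intro!: nn_integral_cong split: split_indicator)
  have "(\<integral>\<^sup>+u. k (reflection u) * indicator {0<..<1/2} u \<partial>lborel) =
      (\<integral>\<^sup>+u. k (1/2 - u) * indicator {0<..<1/2} u \<partial>lborel)"
    by (intro nn_integral_cong) (auto simp: reflection_def split: split_indicator)
  moreover have "(\<integral>\<^sup>+u. k (reflection u) * indicator {1/2<..<1} u \<partial>lborel) =
      (\<integral>\<^sup>+u. k (3/2 - u) * indicator {1/2<..<1} u \<partial>lborel)"
    by (intro nn_integral_cong) (auto simp: reflection_def split: split_indicator)
  ultimately show ?thesis
    by (simp add: split half)
qed

lemma regular_familyD:
  assumes "regular_family F f"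
  shows "real_distribution (density lborel (\<lambda>x. ennreal (f \<theta> x)))"
    and "F \<theta> = cdf (density lborel (\<lambda>x. ennreal (f \<theta> x)))"
    and "smooth (F \<theta>)"
    and "strict_mono (F \<theta>)"
    and "(F \<theta> has_real_derivative f \<theta> x) (at x)"
    and "f \<theta> x > 0"
  using assms unfolding regular_family_def by blast+

text \<open>The density is the derivative of a smooth function, hence differentiable and so
  continuous.\<close>

lemma regular_family_borel_measurable:
  assumes "regular_family F f"
  shows "f \<theta> \<in> borel_measurable borel"
proof -
  have "f \<theta> = deriv (F \<theta>)"
    using DERIV_imp_deriv[OF regular_familyD(5)[OF assms]] by (simp add: fun_eq_iff)
  moreover have "(deriv ^^ 1) (F \<theta>) differentiable (at x)" for x
    using regular_familyD(3)[OF assms] unfolding smooth_def by blast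
  ultimately have "continuous_on UNIV (f \<theta>)"
    by (auto intro!: continuous_at_imp_continuous_on differentiable_imp_continuous_within)
  then show ?thesis
    by (rule borel_measurable_continuous_onI)
qed

lemma regular_family_measurable_cdf:
  assumes "regular_family F f"
  shows "F \<theta> \<in> borel_measurable borel"
  by (intro borel_measurable_mono strict_mono_mono regular_familyD(4)[OF assms])

text \<open>Strict monotonicity keeps the values off 0 and 1, so the transformed data lie in the
  open unit interval for every outcome.\<close>

lemma regular_family_cdf_in_unit_interval:
  assumes "regular_family F f"
  shows "F \<theta> x \<in> {0<..<1}"
proof -
  interpret real_distribution "density lborel (\<lambda>x. ennreal (f \<theta> x))"
    by (rule regular_familyD(1)[OF assms])
  note F = regular_familyD(2)[OF assms, of \<theta>]
  have "F \<theta> (x - 1) \<ge> 0" "F \<theta> (x + 1) \<le> 1"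
    by (auto simp: F cdf_nonneg cdf_bounded_prob)
  moreover have "F \<theta> (x - 1) < F \<theta> x" "F \<theta> x < F \<theta> (x + 1)"
    using regular_familyD(4)[OF assms, of \<theta>] by (auto simp: strict_mono_def)
  ultimately show ?thesis by auto
qed

lemma symmetric_null_sgn:
  assumes "regular_family F f" "symmetric_null F f"
  shows "sgn (F 0 x - 1/2) = sgn x"
proof -
  have "F 0 (- 0) = 1 - F 0 0"
    using assms(2) unfolding symmetric_null_def by blast
  then have "F 0 0 = 1/2" by simp
  moreover have "F 0 x < F 0 y \<longleftrightarrow> x < y" for x y
    by (rule strict_mono_less[OF regular_familyD(4)[OF assms(1)]])
  ultimately show ?thesis
    by (metis diff_gt_0_iff_gt diff_less_0_iff_less linorder_neqE_linordered_idom
        sgn_0 sgn_neg sgn_pos diff_self)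
qed

text \<open>On the side of \<open>1/2\<close> where the declared sign is wrong, the likelihood ratio to the null at a
  rejected point is at most the ratio at its reflection, which is accepted.\<close>

lemma nn_integral_reflection_le:
  fixes \<psi> :: "real \<Rightarrow> ennreal"
  assumes reg: "regular_family F f" and sym: "symmetric_null F f"
    and mlr: "monotone_likelihood_ratio f"
    and [measurable]: "\<psi> \<in> borel_measurable borel"
    and supp: "\<And>y. \<psi> y \<noteq> 0 \<Longrightarrow> y \<in> {0<..<1/4} \<union> {3/4<..<1} \<and> sgn \<theta> \<noteq> sgn (y - 1/2)"
  shows "(\<integral>\<^sup>+x. f \<theta> x * \<psi> (F 0 x) \<partial>lborel) \<le> (\<integral>\<^sup>+x. f \<theta> x * \<psi> (reflection (F 0 x)) \<partial>lborel)"
proof -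
  \<comment> \<open>This locale supplies the quantile function of the null and the fact that it
    carries the uniform law on the unit interval to the null distribution.\<close>
  interpret cdf_distribution "density lborel (\<lambda>x. ennreal (f 0 x))"
    using regular_familyD(1)[OF reg] by (simp add: cdf_distribution_def)
  note [measurable] = regular_family_borel_measurable[OF reg] regular_family_measurable_cdf[OF reg]
  note F0 = regular_familyD(2)[OF reg, of 0, symmetric]
  note sm = regular_familyD(4)[OF reg, of 0]
  note dF = regular_familyD(5)[OF reg, of 0]
  note pos = regular_familyD(6)[OF reg]
  have less_iff: "F 0 x < F 0 y \<longleftrightarrow> x < y" for x y
    using sm by (rule strict_mono_less)
  define Q where "Q u = Inf {x. u \<le> F 0 x}" for u
  have Q: "u \<le> F 0 x \<longleftrightarrow> Q u \<le> x" if "u \<in> {0<..<1}" for u x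
    using pseudoinverse[of u x] that by (simp add: Q_def F0)
  \<comment> \<open>One inequality is the Galois property \<open>Q\<close>; the other uses
    continuity of \<open>F 0\<close> from the left, as all points below \<open>Q u\<close> have
    value at most \<open>u\<close>.\<close>
  have FQ: "F 0 (Q u) = u" if u: "u \<in> {0<..<1}" for u
  proof (rule antisym)
    show "F 0 (Q u) \<le> u"
    proof (rule tendsto_upperbound)
      show "(F 0 \<longlongrightarrow> F 0 (Q u)) (at_left (Q u))"
        using continuous_at_imp_continuous_at_within[OF DERIV_isCont[OF dF]]
        by (simp add: continuous_within)
      show "\<forall>\<^sub>F x in at_left (Q u). F 0 x \<le> u"
        using Q[OF u] by (auto simp: eventually_at_filter intro!: always_eventually)
          (meson linear not_le)
    qed simp
  qed (use Q[OF u] in auto)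
  have Q_less: "Q u < Q v" if "u < v" "u \<in> {0<..<1}" "v \<in> {0<..<1}" for u v
    using that less_iff[of "Q u" "Q v"] FQ by auto
  define r where "r x = f \<theta> x / f 0 x" for x
  have [measurable]: "r \<in> borel_measurable borel"
    unfolding r_def by measurable
  \<comment> \<open>The density of the transformed variable under \<open>\<theta>\<close>: the
    likelihood ratio to the null at the quantile, extended by 0.\<close>
  define g where "g u = ennreal (r (Q u)) * indicator {0<..<1} u" for u
  have Qm: "Q \<in> borel_measurable (restrict_space borel {0<..<1})"
    using measurable_CI by (simp add: Q_def[abs_def] F0)
  have Qm': "Q \<in> borel_measurable (restrict_space lborel {0<..<1})"
    using Qm by (simp cong: measurable_cong_sets add: sets_restrict_space)
  have "(\<lambda>u. ennreal (r (Q u))) \<in> borel_measurable (restrict_space borel {0<..<1})"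
    using Qm by measurable
  then have [measurable]: "g \<in> borel_measurable borel"
    unfolding g_def[abs_def] by (subst (asm) borel_measurable_restrict_space_iff_ennreal) auto
  \<comment> \<open>Change of variables: write \<open>f \<theta>\<close> as the null density times
    \<open>r\<close>, then represent the null by a uniform variable through
    \<open>Q\<close>.\<close>
  have law: "(\<integral>\<^sup>+x. f \<theta> x * h (F 0 x) \<partial>lborel) = (\<integral>\<^sup>+u. h u * g u * indicator {0<..<1} u \<partial>lborel)"
    if [measurable]: "h \<in> borel_measurable borel" for h :: "real \<Rightarrow> ennreal"
  proof -
    have "(\<integral>\<^sup>+x. f \<theta> x * h (F 0 x) \<partial>lborel) = (\<integral>\<^sup>+x. f 0 x * (r x * h (F 0 x)) \<partial>lborel)"
    proof -
      have "ennreal (f \<theta> x) = ennreal (f 0 x) * ennreal (r x)" for x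
        using pos[of 0 x] pos[of \<theta> x] by (simp add: r_def flip: ennreal_mult)
      then show ?thesis
        by (simp add: mult.assoc)
    qed
    also have "\<dots> = (\<integral>\<^sup>+x. r x * h (F 0 x) \<partial>density lborel (\<lambda>x. ennreal (f 0 x)))"
      by (simp add: nn_integral_density)
    also have "\<dots> = (\<integral>\<^sup>+x. r x * h (F 0 x) \<partial>distr (restrict_space lborel {0<..<1}) borel Q)"
      using distr_I_eq_M by (simp add: Q_def[abs_def] F0)
    also have "\<dots> = (\<integral>\<^sup>+u. r (Q u) * h (F 0 (Q u)) \<partial>restrict_space lborel {0<..<1})"
      using Qm' by (subst nn_integral_distr) auto
    also have "\<dots> = (\<integral>\<^sup>+u. r (Q u) * h (F 0 (Q u)) * indicator {0<..<1} u \<partial>lborel)"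
      by (subst nn_integral_restrict_space) auto
    also have "\<dots> = (\<integral>\<^sup>+u. h u * g u * indicator {0<..<1} u \<partial>lborel)"
      by (intro nn_integral_cong) (auto simp: FQ g_def mult_ac split: split_indicator)
    finally show ?thesis .
  qed
  have mono: "r x \<le> r y" if "\<theta> > 0" "x < y" for x y
    using mlr that by (auto simp: monotone_likelihood_ratio_def r_def)
  \<comment> \<open>For negative \<open>\<theta>\<close> the monotone ratio has the null in the
    numerator, so \<open>r\<close> is its reciprocal.\<close>
  have anti: "r y \<le> r x" if "\<theta> < 0" "x < y" for x y
  proof -
    have "f 0 x / f \<theta> x \<le> f 0 y / f \<theta> y"
      using mlr that by (auto simp: monotone_likelihood_ratio_def)
    then show ?thesis
      using pos[of 0 x] pos[of 0 y] pos[of \<theta> x] pos[of \<theta> y] by (simp add: r_def field_simps)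
  qed
  have const: "r x = 1" if "\<theta> = 0" for x
    using pos[of 0 x] that by (simp add: r_def)
  \<comment> \<open>For positive \<open>\<theta>\<close> a wrong sign puts \<open>u\<close> below
    1/4 and reflection moves it up; for negative \<open>\<theta>\<close> it is above 3/4 and moves
    down. Either way the ratio does not decrease.\<close>
  have g_le: "g u \<le> g (reflection u)" if "\<psi> u \<noteq> 0" for u
  proof -
    have u: "u \<in> {0<..<1/4} \<union> {3/4<..<1}" "sgn \<theta> \<noteq> sgn (u - 1/2)"
      using supp[OF that] by auto
    have "r (Q u) \<le> r (Q (reflection u))"
    proof (cases \<theta> "0::real" rule: linorder_cases)
      case less
      then have "u \<in> {3/4<..<1}" using u by auto
      then show ?thesis
        using less by (auto simp: reflection_def intro!: anti Q_less)
    next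
      case greater
      then have "u \<in> {0<..<1/4}" using u by auto
      then show ?thesis
        using greater by (auto simp: reflection_def intro!: mono Q_less)
    qed (simp add: const)
    then show ?thesis
      using u by (auto simp: g_def reflection_def split: split_indicator intro: ennreal_leI)
  qed
  have "(\<integral>\<^sup>+x. f \<theta> x * \<psi> (F 0 x) \<partial>lborel) = (\<integral>\<^sup>+u. \<psi> u * g u * indicator {0<..<1} u \<partial>lborel)"
    by (rule law) measurable
  also have "\<dots> \<le> (\<integral>\<^sup>+u. \<psi> u * g (reflection u) * indicator {0<..<1} u \<partial>lborel)"
    by (intro nn_integral_mono mult_right_mono) (metis g_le mult_left_mono mult_zero_left zero_le, simp)
  \<comment> \<open>Reflection is its own inverse on the open unit interval; in this form the
    integrand depends on \<open>reflection u\<close> alone, so measure preservation applies.\<close>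
  also have "\<dots> = (\<integral>\<^sup>+u. \<psi> (reflection (reflection u)) * g (reflection u) * indicator {0<..<1} u \<partial>lborel)"
    using AE_lborel_singleton[of "1/2::real"]
    by (intro nn_integral_cong_AE) (auto elim!: eventually_mono simp: reflection_def split: split_indicator)
  also have "\<dots> = (\<integral>\<^sup>+u. \<psi> (reflection u) * g u * indicator {0<..<1} u \<partial>lborel)"
    by (rule nn_integral_reflection[of "\<lambda>u. \<psi> (reflection u) * g u"]) measurable
  also have "\<dots> = (\<integral>\<^sup>+x. f \<theta> x * \<psi> (reflection (F 0 x)) \<partial>lborel)"
    by (rule law[symmetric]) measurable
  finally show ?thesis .
qed

subsection \<open>Measurability of the procedure\<close>

lemma partially_masked_restrict:
  "partially_masked m M (restrict u {1..m}) = partially_masked m M u"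
  by (auto simp: partially_masked_def)

lemma masked_set_restrict:
  "masked_set m upd (restrict u {1..m}) t = masked_set m upd u t"
  by (induction t) (simp_all only: masked_set.simps partially_masked_restrict)

text \<open>Measurability concerns vectors undefined outside \<open>{1..m}\<close>, while the
  procedure is run on a total function; this passes between the two.\<close>

lemma zdirect_restrict:
  assumes "admissible_update m q upd"
  shows "zdirect m q upd (restrict u {1..m}) = zdirect m q upd u"
proof -
  have "acceptance_set m upd (restrict u {1..m}) t = acceptance_set m upd u t"
    and "rejection_set m upd (restrict u {1..m}) t = rejection_set m upd u t" for t
    using masked_set_subset[OF assms, of u t]
    unfolding acceptance_set_def rejection_set_def masked_set_restrict by auto
  then show ?thesis
    by (simp add: zdirect_def fdr_dir_hat_def)
qed

lemma zdirect_subset: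
  assumes "admissible_update m q upd"
  shows "zdirect m q upd u \<subseteq> {1..m}"
  using masked_set_subset[OF assms] by (auto simp: zdirect_def rejection_set_def)

lemma borel_measurable_masked_value [measurable]: "masked_value \<in> borel_measurable borel"
  unfolding masked_value_def by measurable

text \<open>The current masked set enters the next step as a parameter with finitely many values;
  for each fixed value the step is a measurable composition.\<close>

lemma measurable_masked_set:
  assumes adm: "admissible_update m q upd"
  shows "(\<lambda>u. masked_set m upd u t) \<in> measurable (PiM {1..m} (\<lambda>_. borel)) (count_space (Pow {1..m}))"
proof (induction t)
  case (Suc t)
  have "(\<lambda>u. if M = {} then {} else upd t (partially_masked m M u))
      \<in> measurable (PiM {1..m} (\<lambda>_. borel)) (count_space (Pow {1..m}))" for M
  proof -
    have "partially_masked m M \<in> measurable (PiM {1..m} (\<lambda>_. borel)) (PiM {1..m} (\<lambda>_. borel))"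
      unfolding partially_masked_def by (intro measurable_restrict) measurable
    moreover have "upd t \<in> measurable (PiM {1..m} (\<lambda>_. borel)) (count_space (Pow {1..m}))"
      using adm by (simp add: admissible_update_def)
    ultimately have "(\<lambda>u. upd t (partially_masked m M u))
        \<in> measurable (PiM {1..m} (\<lambda>_. borel)) (count_space (Pow {1..m}))"
      by (rule measurable_compose)
    then show ?thesis by (cases "M = {}") auto
  qed
  from measurable_compose_countable'[OF this Suc] show ?case
    by (simp add: countable_finite)
qed simp

lemma pred_masked_set:
  assumes "admissible_update m q upd"
  shows "Measurable.pred (PiM {1..m} (\<lambda>_. borel)) (\<lambda>u. i \<in> masked_set m upd u t)"
  by (rule measurable_compose[OF measurable_masked_set[OF assms]]) simp

lemma pred_masked_set_Int:
  fixes B :: "real set"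
  assumes "admissible_update m q upd" and [measurable]: "B \<in> sets borel"
  shows "Measurable.pred (PiM {1..m} (\<lambda>_. borel)) (\<lambda>u. i \<in> masked_set m upd u t \<and> u i \<in> B)"
proof (cases "i \<in> {1..m}")
  case True
  note [measurable] = pred_masked_set[OF assms(1)]
  from True show ?thesis by measurable
next
  \<comment> \<open>Such an index has no coordinate projection in the product, but it never belongs
    to a masked set.\<close>
  case False
  then have "i \<notin> masked_set m upd u t" for u
    using masked_set_subset[OF assms(1), of u t] by blast
  then show ?thesis by simp
qed

lemma borel_measurable_fdr_dir_hat:
  assumes adm: "admissible_update m q upd"
  shows "(\<lambda>u. fdr_dir_hat m upd u t) \<in> borel_measurable (PiM {1..m} (\<lambda>_. borel))"
proof -
  have card: "(\<lambda>u. card {i \<in> masked_set m upd u t. u i \<in> B})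
      \<in> measurable (PiM {1..m} (\<lambda>_. borel)) (count_space UNIV)"
    if "B \<in> sets borel" for B
    using pred_masked_set_Int[OF adm that]
    by (intro measurable_card) (simp add: pred_def)
  have [measurable]: "(\<lambda>u. card (acceptance_set m upd u t))
      \<in> measurable (PiM {1..m} (\<lambda>_. borel)) (count_space UNIV)"
    unfolding acceptance_set_def by (rule card) simp
  have [measurable]: "(\<lambda>u. card (rejection_set m upd u t))
      \<in> measurable (PiM {1..m} (\<lambda>_. borel)) (count_space UNIV)"
    unfolding rejection_set_def by (rule card) simp
  show ?thesis
    unfolding fdr_dir_hat_def by measurable
qed

lemma borel_measurable_false_rejection_weight:
  assumes adm: "admissible_update m q upd" and i: "i \<in> {1..m}"
  shows "false_rejection_weight m q upd \<theta> i \<in> borel_measurable (PiM {1..m} (\<lambda>_. borel))"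
proof -
  let ?N = "PiM {1..m} (\<lambda>_. borel) :: (nat \<Rightarrow> real) measure"
  note [measurable] = borel_measurable_fdr_dir_hat[OF adm]
  have stop [measurable]: "stop_step m q upd \<in> measurable ?N (count_space UNIV)"
    unfolding stop_step_def by measurable
  \<comment> \<open>The stopping step is random but has countably many values, so each fixed step
    can be treated separately.\<close>
  have final: "Measurable.pred ?N (\<lambda>u. j \<in> final_set m q upd u \<and> u j \<in> B)"
    if "B \<in> sets borel" for j B
    unfolding final_set_def
    by (rule measurable_compose_countable[OF pred_masked_set_Int[OF adm that] stop])
  have [measurable]: "Measurable.pred ?N (\<lambda>u. i \<in> final_set m q upd u)"
    using final[of UNIV i] by simp
  have false_acc: "Measurable.pred ?N (\<lambda>u. j \<in> false_acceptances \<theta> (final_set m q upd u) u)" for j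
  proof -
    have "{1/4<..<3/4} \<inter> {y. sgn (\<theta> j) \<noteq> sgn (y - 1/2)} \<in> sets borel"
      by measurable
    from final[OF this, of j] show ?thesis
      by (simp add: false_acceptances_def)
  qed
  have [measurable]: "(\<lambda>u. card (false_acceptances \<theta> (final_set m q upd u) u))
      \<in> measurable ?N (count_space UNIV)"
    using false_acc by (intro measurable_card) (simp add: pred_def)
  have [measurable]: "Measurable.pred ?N (generic m)"
    unfolding generic_def by measurable
  show ?thesis
    using i unfolding false_rejection_weight_def false_rejection_def by measurable
qed

subsection \<open>Control of the directional false discovery rate\<close>

text \<open>By independence the joint law is a product, so coordinate \<open>i\<close> can be
  integrated first with the others frozen; the hypothesis compares these inner integrals.\<close>

lemma (in prob_space) nn_integral_indep_vars_coordinate_mono: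
  fixes G :: "('i \<Rightarrow> 'b) \<Rightarrow> ennreal"
  assumes indep: "indep_vars M' X I" and fin: "finite I" and i: "i \<in> I"
    and [measurable]: "G \<in> borel_measurable (PiM I M')" "T \<in> measurable (M' i) (M' i)"
    and le: "\<And>x. x \<in> space (PiM (I - {i}) M') \<Longrightarrow>
      (\<integral>\<^sup>+\<omega>. G (x(i := X i \<omega>)) \<partial>M) \<le> (\<integral>\<^sup>+\<omega>. G (x(i := T (X i \<omega>))) \<partial>M)"
  shows "(\<integral>\<^sup>+\<omega>. G (\<lambda>j\<in>I. X j \<omega>) \<partial>M) \<le> (\<integral>\<^sup>+\<omega>. G ((\<lambda>j\<in>I. X j \<omega>)(i := T (X i \<omega>))) \<partial>M)"
proof -
  have X [measurable]: "X j \<in> measurable M (M' j)" if "j \<in> I" for j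
    using indep that by (auto simp: indep_vars_def)
  \<comment> \<open>The product locale wants a sigma-finite measure at every index; outside
    \<open>I\<close> the law of \<open>X i\<close> serves as a filler.\<close>
  define D where "D j = (if j \<in> I then distr M (M' j) (X j) else distr M (M' i) (X i))" for j
  have prob_D: "prob_space (D j)" for j
    using i by (auto simp: D_def intro!: prob_space_distr)
  interpret product_sigma_finite D
    using prob_D by (simp add: product_sigma_finite_def prob_space_imp_sigma_finite)
  have sets_PiM_D: "sets (PiM J D) = sets (PiM J M')" if "J \<subseteq> I" for J
    using that by (intro sets_PiM_cong) (auto simp: D_def)
  have I: "insert i (I - {i}) = I"
    using i by auto
  have distr: "distr M (PiM I M') (\<lambda>\<omega>. \<lambda>j\<in>I. X j \<omega>) = PiM I D"
  proof -
    have "I \<noteq> {}"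
      using i by auto
    from indep_vars_iff_distr_eq_PiM'[OF this X] indep
    have "distr M (PiM I M') (\<lambda>\<omega>. \<lambda>j\<in>I. X j \<omega>) = (\<Pi>\<^sub>M j\<in>I. distr M (M' j) (X j))"
      by simp
    also have "\<dots> = PiM I D"
      by (intro PiM_cong) (auto simp: D_def)
    finally show ?thesis .
  qed
  have slice: "(\<integral>\<^sup>+\<omega>. H (\<lambda>j\<in>I. X j \<omega>) \<partial>M) =
      (\<integral>\<^sup>+x. (\<integral>\<^sup>+\<omega>. H (x(i := X i \<omega>)) \<partial>M) \<partial>PiM (I - {i}) D)"
    if [measurable]: "H \<in> borel_measurable (PiM I M')" for H :: "('i \<Rightarrow> 'b) \<Rightarrow> ennreal"
  proof -
    have "(\<integral>\<^sup>+\<omega>. H (\<lambda>j\<in>I. X j \<omega>) \<partial>M) = integral\<^sup>N (PiM I D) H"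
      unfolding distr[symmetric] by (subst nn_integral_distr) (auto intro!: measurable_restrict)
    also have "\<dots> = (\<integral>\<^sup>+x. (\<integral>\<^sup>+y. H (x(i := y)) \<partial>D i) \<partial>PiM (I - {i}) D)"
    proof (subst product_nn_integral_insert[of "I - {i}" i H, unfolded I])
      show "H \<in> borel_measurable (PiM I D)"
        using that measurable_cong_sets[OF sets_PiM_D[OF order_refl] refl] by blast
    qed (use fin in auto)
    also have "\<dots> = (\<integral>\<^sup>+x. (\<integral>\<^sup>+\<omega>. H (x(i := X i \<omega>)) \<partial>M) \<partial>PiM (I - {i}) D)"
    proof (intro nn_integral_cong)
      fix x assume "x \<in> space (PiM (I - {i}) D)"
      then have "x \<in> space (PiM (I - {i}) M')"
        using sets_eq_imp_space_eq[OF sets_PiM_D, of "I - {i}"] by auto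
      then have "(\<lambda>y. x(i := y)) \<in> measurable (M' i) (PiM I M')"
        using measurable_component_update[of x "I - {i}" M' i] I by simp
      then have "(\<lambda>y. H (x(i := y))) \<in> borel_measurable (M' i)"
        by measurable
      then show "(\<integral>\<^sup>+y. H (x(i := y)) \<partial>D i) = (\<integral>\<^sup>+\<omega>. H (x(i := X i \<omega>)) \<partial>M)"
        using i by (simp add: D_def nn_integral_distr)
    qed
    finally show ?thesis .
  qed
  have T: "(\<lambda>u. u(i := T (u i))) \<in> measurable (PiM I M') (PiM I M')"
    using i by (intro measurable_fun_upd[where J = I]) auto
  have "(\<integral>\<^sup>+\<omega>. G (\<lambda>j\<in>I. X j \<omega>) \<partial>M) = (\<integral>\<^sup>+x. (\<integral>\<^sup>+\<omega>. G (x(i := X i \<omega>)) \<partial>M) \<partial>PiM (I - {i}) D)"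
    by (rule slice) measurable
  also have "\<dots> \<le> (\<integral>\<^sup>+x. (\<integral>\<^sup>+\<omega>. G (x(i := T (X i \<omega>))) \<partial>M) \<partial>PiM (I - {i}) D)"
    using sets_eq_imp_space_eq[OF sets_PiM_D, of "I - {i}"] by (intro nn_integral_mono le) auto
  also have "\<dots> = (\<integral>\<^sup>+\<omega>. G ((\<lambda>j\<in>I. X j \<omega>)(i := T (X i \<omega>))) \<partial>M)"
    using slice[of "\<lambda>u. G (u(i := T (u i)))"] T i by simp
  finally show ?thesis .
qed

theorem theorem3p1:
  fixes P :: "'a measure"
    and m :: nat
    and F f :: "nat \<Rightarrow> real \<Rightarrow> real \<Rightarrow> real"
    and \<theta> :: "nat \<Rightarrow> real"
    and z :: "nat \<Rightarrow> 'a \<Rightarrow> real"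
    and q :: real
    and upd :: "nat \<Rightarrow> (nat \<Rightarrow> real) \<Rightarrow> nat set"
  assumes "prob_space P"
    and "\<And>i. i \<in> {1..m} \<Longrightarrow> regular_family (F i) (f i)"
    and "\<And>i. i \<in> {1..m} \<Longrightarrow> symmetric_null (F i) (f i)"
    and "\<And>i. i \<in> {1..m} \<Longrightarrow> monotone_likelihood_ratio (f i)"
    and "prob_space.indep_vars P (\<lambda>_. borel) z {1..m}"
    and "\<And>i. i \<in> {1..m} \<Longrightarrow> cdf (distr P borel (z i)) = F i (\<theta> i)"
    and "\<And>i. i \<in> {1..m} \<Longrightarrow> distributed P lborel (z i) (\<lambda>x. ennreal (f i (\<theta> i) x))"
    and "q \<in> {0<..<1}"
    and "admissible_update m q upd"
  shows "directional_fdr P \<theta> z (\<lambda>\<omega>. zdirect m q upd (\<lambda>i. F i 0 (z i \<omega>))) \<le> q"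
proof -
  interpret prob_space P by fact
  note reg = assms(2) and sym = assms(3) and mlr = assms(4) and indep = assms(5)
    and dist = assms(7) and adm = assms(9)
  have q: "q > 0"
    using assms(8) by simp
  define u where "u \<omega> = (\<lambda>i\<in>{1..m}. F i 0 (z i \<omega>))" for \<omega>
  define G where "G i v = ennreal (false_rejection_weight m q upd \<theta> i v)" for i v
  have weight_nonneg: "false_rejection_weight m q upd \<theta> i v \<ge> 0" for i v
    by (simp add: false_rejection_weight_def)
  note [measurable] = regular_family_measurable_cdf[OF reg]
  have G_meas [measurable]: "G i \<in> borel_measurable (PiM {1..m} (\<lambda>_. borel))" if "i \<in> {1..m}" for i
    using borel_measurable_false_rejection_weight[OF adm that] unfolding G_def by measurable
  have z_meas [measurable]: "z i \<in> borel_measurable P" if "i \<in> {1..m}" for i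
    using distributed_measurable[OF dist[OF that]] by simp
  have u_meas [measurable]: "u \<in> measurable P (PiM {1..m} (\<lambda>_. borel))"
    unfolding u_def by (intro measurable_restrict measurable_compose[OF z_meas regular_family_measurable_cdf[OF reg]])
  have u01: "\<forall>i\<in>{1..m}. u \<omega> i \<in> {0<..<1}" for \<omega>
    using regular_family_cdf_in_unit_interval[OF reg] by (simp add: u_def)
  have upd_meas: "(\<lambda>v. v(i := reflection (v i))) \<in>
      measurable (PiM {1..m} (\<lambda>_. borel)) (PiM {1..m} (\<lambda>_. borel))" if "i \<in> {1..m}" for i
    using that by (intro measurable_fun_upd[where J = "{1..m}"]) auto

  \<comment> \<open>A null distribution function is injective, so each excluded value has at most
    one preimage, and \<open>z i\<close> has a density.\<close>
  have gen: "AE \<omega> in P. generic m (u \<omega>)"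
  proof -
    have "AE \<omega> in P. F i 0 (z i \<omega>) \<noteq> c" if i: "i \<in> {1..m}" for i c
    proof (subst distributed_AE2[OF dist[OF i]])
      show "Measurable.pred lborel (\<lambda>x. F i 0 x \<noteq> c)"
        using i by measurable
      have "inj (F i 0)"
        using regular_familyD(4)[OF reg[OF i]] by (rule strict_mono_imp_inj_on)
      then have "F i 0 x \<noteq> c" if "x \<noteq> inv (F i 0) c" for x
        using that by auto
      then show "AE x in lborel. 0 < ennreal (f i (\<theta> i) x) \<longrightarrow> F i 0 x \<noteq> c"
        using AE_lborel_singleton[of "inv (F i 0) c"] by (auto elim!: eventually_mono)
    qed
    then have "AE \<omega> in P. \<forall>i\<in>{1..m}. \<forall>c\<in>{1/4, 1/2, 3/4}. F i 0 (z i \<omega>) \<noteq> c"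
      by (intro AE_finite_allI) auto
    then show ?thesis
    proof eventually_elim
      case (elim \<omega>)
      then show ?case
        using u01[of \<omega>] by (auto simp: generic_def u_def)
    qed
  qed

  have reflect: "(\<integral>\<^sup>+\<omega>. G i (u \<omega>) \<partial>P) \<le> (\<integral>\<^sup>+\<omega>. G i ((u \<omega>)(i := reflection (u \<omega> i))) \<partial>P)"
    if i: "i \<in> {1..m}" for i
  proof -
    have "indep_vars (\<lambda>_. borel) (\<lambda>i \<omega>. F i 0 (z i \<omega>)) {1..m}"
      by (rule indep_vars_compose2[OF indep]) measurable
    then have "(\<integral>\<^sup>+\<omega>. G i (\<lambda>j\<in>{1..m}. F j 0 (z j \<omega>)) \<partial>P) \<le>
        (\<integral>\<^sup>+\<omega>. G i ((\<lambda>j\<in>{1..m}. F j 0 (z j \<omega>))(i := reflection (F i 0 (z i \<omega>)))) \<partial>P)"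
    proof (rule nn_integral_indep_vars_coordinate_mono[where T = reflection])
      fix x :: "nat \<Rightarrow> real" assume x: "x \<in> space (PiM ({1..m} - {i}) (\<lambda>_. borel))"
      \<comment> \<open>The weight as a function of coordinate \<open>i\<close> alone. It vanishes
        except at rejected values with a wrong sign, where the likelihood ratio comparison is
        available.\<close>
      define \<psi> where "\<psi> y = G i (x(i := y))" for y
      have "(\<lambda>y. x(i := y)) \<in> measurable borel (PiM {1..m} (\<lambda>_. borel))"
        using measurable_component_update[OF x, of i] i by (simp add: insert_absorb)
      then have \<psi> [measurable]: "\<psi> \<in> borel_measurable borel"
        unfolding \<psi>_def by (rule measurable_compose[OF _ G_meas[OF i]])
      have supp: "y \<in> {0<..<1/4} \<union> {3/4<..<1} \<and> sgn (\<theta> i) \<noteq> sgn (y - 1/2)" if "\<psi> y \<noteq> 0" for y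
        using that by (auto simp: \<psi>_def G_def false_rejection_weight_def false_rejection_def split: if_splits)
      have "(\<integral>\<^sup>+\<omega>. \<psi> (F i 0 (z i \<omega>)) \<partial>P) = (\<integral>\<^sup>+x. f i (\<theta> i) x * \<psi> (F i 0 x) \<partial>lborel)"
        using i by (intro distributed_nn_integral[OF dist[OF i], symmetric]) measurable
      also have "\<dots> \<le> (\<integral>\<^sup>+x. f i (\<theta> i) x * \<psi> (reflection (F i 0 x)) \<partial>lborel)"
        by (rule nn_integral_reflection_le[OF reg[OF i] sym[OF i] mlr[OF i] \<psi> supp])
      also have "\<dots> = (\<integral>\<^sup>+\<omega>. \<psi> (reflection (F i 0 (z i \<omega>))) \<partial>P)"
        using i by (intro distributed_nn_integral[OF dist[OF i]]) measurable
      finally show "(\<integral>\<^sup>+\<omega>. G i (x(i := F i 0 (z i \<omega>))) \<partial>P) \<le>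
          (\<integral>\<^sup>+\<omega>. G i (x(i := reflection (F i 0 (z i \<omega>)))) \<partial>P)"
        by (simp add: \<psi>_def)
    qed (use i G_meas[OF i] in simp_all)
    then show ?thesis
      using i by (simp add: u_def)
  qed

  have "(\<integral>\<^sup>+\<omega>. ennreal (\<Sum>i\<in>{1..m}. false_rejection_weight m q upd \<theta> i (u \<omega>)) \<partial>P) =
      (\<integral>\<^sup>+\<omega>. (\<Sum>i\<in>{1..m}. G i (u \<omega>)) \<partial>P)"
    by (simp add: G_def sum_ennreal weight_nonneg)
  also have "\<dots> = (\<Sum>i\<in>{1..m}. \<integral>\<^sup>+\<omega>. G i (u \<omega>) \<partial>P)"
    by (intro nn_integral_sum measurable_compose[OF u_meas G_meas])
  also have "\<dots> \<le> (\<Sum>i\<in>{1..m}. \<integral>\<^sup>+\<omega>. G i ((u \<omega>)(i := reflection (u \<omega> i))) \<partial>P)"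
    by (intro sum_mono reflect)
  also have "\<dots> = (\<integral>\<^sup>+\<omega>. (\<Sum>i\<in>{1..m}. G i ((u \<omega>)(i := reflection (u \<omega> i)))) \<partial>P)"
    by (intro nn_integral_sum[symmetric] measurable_compose[OF measurable_compose[OF u_meas upd_meas] G_meas])
  also have "\<dots> \<le> (\<integral>\<^sup>+\<omega>. 1 \<partial>P)"
  proof (intro nn_integral_mono)
    fix \<omega>
    show "(\<Sum>i\<in>{1..m}. G i ((u \<omega>)(i := reflection (u \<omega> i)))) \<le> 1"
      unfolding G_def using sum_false_rejection_weight_reflection_le_1[OF adm u01]
      by (subst sum_ennreal) (auto simp: weight_nonneg)
  qed
  also have "\<dots> = 1"
    by (simp add: emeasure_space_1)
  finally have sum_le: "(\<integral>\<^sup>+\<omega>. ennreal (\<Sum>i\<in>{1..m}. false_rejection_weight m q upd \<theta> i (u \<omega>)) \<partial>P) \<le> 1" .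

  define fdp where "fdp \<omega> = real (card {i \<in> zdirect m q upd (\<lambda>i. F i 0 (z i \<omega>)). sgn (\<theta> i) \<noteq> sgn (z i \<omega>)})
      / real (max 1 (card (zdirect m q upd (\<lambda>i. F i 0 (z i \<omega>)))))" for \<omega>
  have fdp_le: "AE \<omega> in P. fdp \<omega> \<le> q * (\<Sum>i\<in>{1..m}. false_rejection_weight m q upd \<theta> i (u \<omega>))"
    using gen
  proof eventually_elim
    case (elim \<omega>)
    have Z: "zdirect m q upd (\<lambda>i. F i 0 (z i \<omega>)) = zdirect m q upd (u \<omega>)"
      unfolding u_def by (rule zdirect_restrict[OF adm, symmetric])
    have "sgn (u \<omega> i - 1/2) = sgn (z i \<omega>)" if "i \<in> zdirect m q upd (u \<omega>)" for i
    proof -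
      have "i \<in> {1..m}"
        using zdirect_subset[OF adm] that by blast
      then show ?thesis
        using symmetric_null_sgn[OF reg sym] by (simp add: u_def)
    qed
    then have "{i \<in> zdirect m q upd (u \<omega>). sgn (\<theta> i) \<noteq> sgn (z i \<omega>)} =
        {i \<in> zdirect m q upd (u \<omega>). sgn (\<theta> i) \<noteq> sgn (u \<omega> i - 1/2)}"
      by auto
    then show ?case
      using fdp_le_sum_false_rejection_weight[OF adm elim q] by (simp add: fdp_def Z)
  qed

  have "integral\<^sup>L P fdp \<le> q"
  \<comment> \<open>A function that is not integrable has integral 0 by convention, and the bound is
    then positivity of \<open>q\<close>. Otherwise the expectation equals a nonnegative integral, to
    which the almost sure bound applies.\<close>
  proof (cases "integrable P fdp")
    case True
    have "ennreal (integral\<^sup>L P fdp) = (\<integral>\<^sup>+\<omega>. ennreal (fdp \<omega>) \<partial>P)"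
      using True by (intro nn_integral_eq_integral[symmetric]) (auto simp: fdp_def)
    also have "\<dots> \<le> (\<integral>\<^sup>+\<omega>. ennreal q * ennreal (\<Sum>i\<in>{1..m}. false_rejection_weight m q upd \<theta> i (u \<omega>)) \<partial>P)"
      using fdp_le
      by (intro nn_integral_mono_AE)
        (auto elim!: eventually_mono simp: sum_nonneg weight_nonneg q less_imp_le intro!: ennreal_leI simp flip: ennreal_mult)
    also have "\<dots> = ennreal q * (\<integral>\<^sup>+\<omega>. ennreal (\<Sum>i\<in>{1..m}. false_rejection_weight m q upd \<theta> i (u \<omega>)) \<partial>P)"
      by (intro nn_integral_cmult measurable_compose[OF _ measurable_ennreal] borel_measurable_sum
            measurable_compose[OF u_meas borel_measurable_false_rejection_weight[OF adm]])
    also have "\<dots> \<le> ennreal q * 1"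
      by (intro mult_left_mono sum_le) simp
    finally show ?thesis
      using q by (simp add: ennreal_le_iff)
  next
    case False
    then show ?thesis
      using q by (simp add: not_integrable_integral_eq)
  qed
  then show ?thesis
    by (simp only: directional_fdr_def fdp_def[abs_def])
qed

end
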